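(* Let $\mathcal X$ be a finite set and $x\mapsto W_x$ a map from $\mathcal X$ to pure states on a finite-dimensional Hilbert space $\mathcal H$. Let $0<\epsilon<1$ and $\delta_1,\delta_2>0$. Then $$\log M(\epsilon)\ \ge\ \max_P H_s^{\epsilon-\delta_1-\delta_2}(W_P)-\log\frac{1-\epsilon}{\delta_1\delta_2},\qquad \log M(\epsilon)\ \le\ \max_P H_s^{\epsilon+\delta_1+2\delta_2}(W_P)+\log\frac{1}{\delta_1\delta_2^2},$$ where the maxima are over probability distributions $P$ on $\mathcal X$.
   Context: $M(\epsilon)$ is the number of distinguishable states among $\{W_x\}_{x\in\mathcal X}$ with error probability $\epsilon$: the largest integer $N$ for which there exist $x_1,\dots,x_N\in\mathcal X$ and a POVM $\{\Pi_1,\dots,\Pi_N\}$ on $\mathcal H$ with $\frac1N\sum_{i=1}^N\mathrm{tr}\,W_{x_i}(I-\Pi_i)\le\epsilon$. For a distribution $P$, $W_P:=\sum_x P(x)W_x$. For a state $\rho$ and $\epsilon\in\mathbb R$, $H_s^{\epsilon}(\rho):=\max\{\lambda\in\mathbb R:\mathrm{tr}\,\rho\{\rho\ge e^{-\lambda}\}\le\epsilon\}$, where $\{\rho\ge e^{-\lambda}\}$ is the projection onto the span of eigenvectors of $\rho$ with eigenvalues $\ge e^{-\lambda}$. Logarithms are natural. *)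

theory Defs
  imports "HOL-Analysis.Analysis"
begin

text \<open>The Hilbert space H is modelled as complex^'n for an arbitrary finite type 'n
  (so dim H = CARD('n)); operators on H are matrices complex^'n^'n.\<close>

definition adj :: "complex^'n^'n \<Rightarrow> complex^'n^'n" where
  "adj A = (\<chi> i j. cnj (A $ j $ i))"

definition cinner :: "complex^'n \<Rightarrow> complex^'n \<Rightarrow> complex" where
  "cinner v w = (\<Sum>i\<in>UNIV. cnj (v $ i) * w $ i)"

definition outer :: "complex^'n \<Rightarrow> complex^'n \<Rightarrow> complex^'n^'n" where
  "outer v w = (\<chi> i j. v $ i * cnj (w $ j))"

text \<open>positive semidefinite operator\<close>
definition psd :: "complex^'n^'n \<Rightarrow> bool" where
  "psd A \<longleftrightarrow> (\<forall>v. \<exists>r::real. r \<ge> 0 \<and> cinner v (A *v v) = complex_of_real r)"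

text \<open>pure state: rank-one projector onto a unit vector\<close>
definition pure_state :: "complex^'n^'n \<Rightarrow> bool" where
  "pure_state W \<longleftrightarrow> (\<exists>v. norm v = 1 \<and> W = outer v v)"

text \<open>POVM with N elements Q 0, ..., Q (N-1)\<close>
definition povm :: "nat \<Rightarrow> (nat \<Rightarrow> complex^'n^'n) \<Rightarrow> bool" where
  "povm N Q \<longleftrightarrow> (\<forall>i<N. psd (Q i)) \<and> (\<Sum>i<N. Q i) = mat 1"

definition distinguishable ::
  "('x \<Rightarrow> complex^'n^'n) \<Rightarrow> 'x set \<Rightarrow> real \<Rightarrow> nat \<Rightarrow> bool" where
  "distinguishable W X eps N \<longleftrightarrow>
     (\<exists>xs Q. (\<forall>i<N. xs i \<in> X) \<and> povm N Q \<and>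
        (1 / real N) * (\<Sum>i<N. Re (trace (W (xs i) ** (mat 1 - Q i)))) \<le> eps)"

text \<open>M(eps): number of distinguishable states with error probability eps\<close>
definition Mdist :: "('x \<Rightarrow> complex^'n^'n) \<Rightarrow> 'x set \<Rightarrow> real \<Rightarrow> nat" where
  "Mdist W X eps = (GREATEST N. distinguishable W X eps N)"

text \<open>the projection {rho >= c} onto the span of the eigenvectors of rho
  with eigenvalues >= c\<close>
definition proj_ge :: "complex^'n^'n \<Rightarrow> real \<Rightarrow> complex^'n^'n" where
  "proj_ge rho c = (THE P. adj P = P \<and> P ** P = P \<and>
      range (\<lambda>v. P *v v) =
        module.span (*s) {v. \<exists>mu::real. mu \<ge> c \<and> rho *v v = complex_of_real mu *s v})"

text \<open>H_s^eps(rho) = max {lambda. tr rho {rho >= exp(-lambda)} <= eps},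
  taken as a supremum in the extended reals\<close>
definition Hs :: "real \<Rightarrow> complex^'n^'n \<Rightarrow> ereal" where
  "Hs eps rho = Sup {ereal lam | lam. Re (trace (rho ** proj_ge rho (exp (- lam)))) \<le> eps}"

definition distributions :: "'x set \<Rightarrow> ('x \<Rightarrow> real) set" where
  "distributions X = {P. (\<forall>x\<in>X. 0 \<le> P x) \<and> (\<Sum>x\<in>X. P x) = 1}"

definition mixture :: "('x \<Rightarrow> complex^'n^'n) \<Rightarrow> 'x set \<Rightarrow> ('x \<Rightarrow> real) \<Rightarrow> complex^'n^'n" where
  "mixture W X P = (\<Sum>x\<in>X. P x *\<^sub>R W x)"

end

theory Submission
  imports Defs
begin

text \<open>Let \<open>T(c) = tr \<rho>\<^sub>P {\<rho>\<^sub>P \<ge> c}\<close> be the total weight of the eigenvalues \<open>\<ge> c\<close> of the mixture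
  \<open>\<rho>\<^sub>P = \<Sum>\<^sub>x P x |\<psi>\<^sub>x\<rangle>\<langle>\<psi>\<^sub>x|\<close>. Averaged over \<open>P\<close>, the states \<open>\<psi>\<^sub>x\<close> have total weight at most
  \<open>T(c) + c k\<close> on any \<open>k\<close> orthonormal vectors.

  Lower bound: if \<open>T(c) \<le> \<epsilon> - \<delta>\<^sub>1 - \<delta>\<^sub>2\<close>, a greedy Gram--Schmidt construction yields about
  \<open>\<delta>\<^sub>1 / c\<close> orthonormal vectors, each with overlap at least \<open>1 - \<epsilon> + \<delta>\<^sub>2\<close> with some \<open>\<psi>\<^sub>x\<close>.
  Using each of them for about \<open>\<delta>\<^sub>2 / (1 - \<epsilon>)\<close> messages gives a code with error \<open>\<epsilon>\<close> and
  \<open>\<delta>\<^sub>1 \<delta>\<^sub>2 / (c (1 - \<epsilon>))\<close> messages.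

  Upper bound: take an optimal code with \<open>M\<close> messages, its empirical distribution \<open>P\<close> and
  \<open>c = 1 / (M \<delta>\<^sub>1 \<delta>\<^sub>2\<^sup>2)\<close>. There are at most \<open>1 / c\<close> eigenvalues \<open>\<ge> c\<close>; splitting every \<open>\<psi>\<^sub>x\<close>
  into its parts inside and outside their span gives
  \<open>M (1 - \<epsilon>) \<le> (1 + 1/\<delta>\<^sub>2) M \<delta>\<^sub>1 \<delta>\<^sub>2\<^sup>2 + (1 + \<delta>\<^sub>2) M (1 - T(c))\<close>, hence \<open>T(c) \<le> \<epsilon> + \<delta>\<^sub>1 + 2\<delta>\<^sub>2\<close>.\<close>

section \<open>Sesquilinear algebra on complex vectors\<close>

lemma cinner_add_right: "cinner v (w + z) = cinner v w + cinner v z"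
  by (simp add: cinner_def distrib_left sum.distrib)

lemma cinner_add_left: "cinner (v + w) z = cinner v z + cinner w z"
  by (simp add: cinner_def distrib_right sum.distrib)

lemma cinner_diff_right: "cinner v (w - z) = cinner v w - cinner v z"
  by (simp add: cinner_def right_diff_distrib sum_subtractf)

lemma cinner_diff_left: "cinner (v - w) z = cinner v z - cinner w z"
  by (simp add: cinner_def left_diff_distrib sum_subtractf)

lemma cinner_scale_right: "cinner v (a *s w) = a * cinner v w"
  by (simp add: cinner_def sum_distrib_left algebra_simps)

lemma cinner_scale_left: "cinner (a *s v) w = cnj a * cinner v w"
  by (simp add: cinner_def sum_distrib_left algebra_simps)

lemma cinner_zero_right [simp]: "cinner v 0 = 0"
  by (simp add: cinner_def)

lemma cinner_zero_left [simp]: "cinner 0 v = 0"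
  by (simp add: cinner_def)

lemma cinner_sum_right: "cinner v (sum f S) = (\<Sum>x\<in>S. cinner v (f x))"
  by (induction S rule: infinite_finite_induct) (auto simp: cinner_add_right)

lemma cinner_sum_left: "cinner (sum f S) v = (\<Sum>x\<in>S. cinner (f x) v)"
  by (induction S rule: infinite_finite_induct) (auto simp: cinner_add_left)

lemma cinner_commute: "cinner v w = cnj (cinner w v)"
  by (simp add: cinner_def mult.commute)

lemma cmod_cinner_commute: "cmod (cinner v w) = cmod (cinner w v)"
  by (simp add: cinner_commute[of v w])

lemma Re_cinner_self [simp]: "Re (cinner v v) = (norm v)\<^sup>2"
proof -
  have "Re (cinner v w) = inner v w" for w
    by (simp add: cinner_def inner_vec_def inner_complex_def)
  then show ?thesis
    by (simp add: power2_norm_eq_inner)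
qed

lemma cinner_self: "cinner v v = complex_of_real ((norm v)\<^sup>2)"
proof -
  have "Im (cinner v v) = 0"
    by (simp add: cinner_def Im_sum)
  then show ?thesis
    by (simp add: complex_eq_iff)
qed

lemma norm_smult: "norm (a *s (v::complex^'n)) = cmod a * norm v"
  unfolding norm_vec_def by (simp add: norm_mult L2_set_right_distrib)

lemma cnj_mult_self: "cnj z * z = complex_of_real ((cmod z)\<^sup>2)"
  by (metis complex_norm_square mult.commute of_real_power)

lemma cinner_cnj_mult_self: "cinner v w * cinner w v = complex_of_real ((cmod (cinner v w))\<^sup>2)"
proof -
  have "cinner v w * cinner w v = cnj (cinner v w) * cinner v w"
    by (simp add: cinner_commute[of w v])
  then show ?thesis
    by (simp only: cnj_mult_self)
qed

lemma outer_mult_vec: "outer a b *v v = cinner b v *s a"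
  by (simp add: outer_def matrix_vector_mult_def cinner_def vec_eq_iff sum_distrib_left
      algebra_simps)

lemma cinner_outer_self: "cinner v (outer u u *v v) = complex_of_real ((cmod (cinner u v))\<^sup>2)"
  by (simp add: outer_mult_vec cinner_scale_right cinner_cnj_mult_self)

lemma matrix_vector_mult_sum_rdistrib: "sum f S *v v = (\<Sum>x\<in>S. f x *v v)"
  by (induction S rule: infinite_finite_induct) (auto simp: matrix_vector_mult_add_rdistrib)

lemma matrix_vector_mult_sum_distrib: "A *v sum f S = (\<Sum>x\<in>S. A *v (f x :: complex^'n))"
  by (induction S rule: infinite_finite_induct) (auto simp: matrix_vector_right_distrib)

lemma matrix_vector_mult_scaleR_left:
  "(r *\<^sub>R A) *v v = complex_of_real r *s (A *v (v :: complex^'n))"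
  by (simp add: matrix_vector_mult_def vec_eq_iff sum_distrib_left algebra_simps)
    (simp add: scaleR_conv_of_real algebra_simps)

lemma matrix_vector_mult_smult: "A *v (a *s v) = a *s (A *v (v :: complex^'n))"
  by (simp add: matrix_vector_mult_def vec_eq_iff sum_distrib_left algebra_simps)

lemma trace_outer_mult: "trace (outer a b ** A) = cinner b (A *v a)"
  by (simp add: trace_def outer_def matrix_matrix_mult_def cinner_def matrix_vector_mult_def
      sum_distrib_left algebra_simps) (subst sum.swap, simp add: algebra_simps)

lemma trace_mult_outer: "trace (A ** outer a b) = cinner b (A *v a)"
  by (simp add: trace_def outer_def matrix_matrix_mult_def cinner_def matrix_vector_mult_def
      sum_distrib_left algebra_simps)

lemma trace_mult_sum_right:
  "trace (A ** sum f S) = (\<Sum>x\<in>S. trace (A ** (f x :: complex^'n^'n)))"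
  by (induction S rule: infinite_finite_induct)
    (auto simp: trace_def matrix_matrix_mult_def distrib_left sum.distrib)

lemma cinner_adj: "cinner x (A *v y) = cinner (adj A *v x) y"
  by (simp add: cinner_def adj_def matrix_vector_mult_def sum_distrib_left sum_distrib_right
      algebra_simps) (subst sum.swap, simp add: algebra_simps)

lemma adj_outer_self: "adj (outer u u) = outer u u"
  by (simp add: adj_def outer_def vec_eq_iff mult.commute)

lemma adj_sum: "adj (sum f S) = (\<Sum>x\<in>S. adj (f x))"
  by (simp add: adj_def vec_eq_iff sum_component)

section \<open>Orthonormal sets\<close>

definition orthonormal :: "(complex^'n) set \<Rightarrow> bool" where
  "orthonormal B \<longleftrightarrow> (\<forall>u\<in>B. \<forall>v\<in>B. cinner u v = (if u = v then 1 else 0))"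

definition orth_residual :: "(complex^'n) set \<Rightarrow> complex^'n \<Rightarrow> complex^'n" where
  "orth_residual F v = v - (\<Sum>f\<in>F. cinner f v *s f)"

definition orthonormal_basis :: "(complex^'n) set \<Rightarrow> bool" where
  "orthonormal_basis B \<longleftrightarrow> orthonormal B \<and> (\<forall>v. orth_residual B v = 0)"

lemma orthonormalD: "orthonormal B \<Longrightarrow> u \<in> B \<Longrightarrow> v \<in> B \<Longrightarrow> cinner u v = (if u = v then 1 else 0)"
  unfolding orthonormal_def by blast

lemma orthonormal_subset: "orthonormal B \<Longrightarrow> C \<subseteq> B \<Longrightarrow> orthonormal C"
  unfolding orthonormal_def by blast

lemma orthonormal_norm:
  assumes "orthonormal B" "u \<in> B"
  shows "norm u = 1"
proof -
  have "complex_of_real ((norm u)\<^sup>2) = complex_of_real 1"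
    using orthonormalD[OF assms assms(2)] by (simp add: cinner_self)
  then have "(norm u)\<^sup>2 = 1"
    using of_real_eq_iff by blast
  then show ?thesis
    using norm_ge_zero[of u] by (simp add: power2_eq_1_iff)
qed

lemma cinner_orthonormal_sum:
  assumes "orthonormal B" "f \<in> B" "F \<subseteq> B" "finite F"
  shows "cinner f (\<Sum>g\<in>F. c g *s g) = (if f \<in> F then c f else 0)"
proof -
  have "cinner f (\<Sum>g\<in>F. c g *s g) = (\<Sum>g\<in>F. c g * cinner f g)"
    by (simp add: cinner_sum_right cinner_scale_right)
  also have "\<dots> = (\<Sum>g\<in>F. if g = f then c g else 0)"
    using assms unfolding orthonormal_def by (intro sum.cong) auto
  finally show ?thesis
    using assms(4) by simp
qed

lemma orthonormal_independent:
  assumes "orthonormal B"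
  shows "vec.independent B"
  unfolding vec.independent_explicit_module
proof (intro allI impI)
  fix T c v
  assume T: "finite T" "T \<subseteq> B" "(\<Sum>u\<in>T. c u *s u) = 0" "v \<in> T"
  then show "c v = 0"
    using cinner_orthonormal_sum[OF assms _ T(2,1), of v c] by auto
qed

lemma orthonormal_finite: "orthonormal B \<Longrightarrow> finite B"
  using orthonormal_independent vec.finiteI_independent by blast

lemma card_orthonormal_le:
  assumes "orthonormal (B :: (complex^'n) set)"
  shows "card B \<le> CARD('n)"
proof -
  have "card B \<le> vec.dim (UNIV :: (complex^'n) set)"
    using orthonormal_independent[OF assms] vec.independent_card_le_dim[of B UNIV] by simp
  then show ?thesis
    using vec_dim_card[where 'a=complex and 'n='n] by linarith
qed

lemma orthonormal_insert:
  assumes "orthonormal F" "norm w = 1" "\<forall>u\<in>F. cinner u w = 0"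
  shows "orthonormal (insert w F)" "w \<notin> F"
proof -
  have ww: "cinner w w = 1"
    using assms(2) by (simp add: cinner_self)
  then show "w \<notin> F"
    using assms(3) by force
  have "cinner w u = 0" if "u \<in> F" for u
    using assms(3) that cinner_commute[of w u] by simp
  with assms ww show "orthonormal (insert w F)"
    unfolding orthonormal_def by auto
qed

lemma cinner_sum_orthonormal_sum:
  assumes "orthonormal B" "F \<subseteq> B"
  shows "cinner (\<Sum>f\<in>F. a f *s f) (\<Sum>g\<in>F. c g *s g) = (\<Sum>f\<in>F. cnj (a f) * c f)"
proof -
  have fin: "finite F"
    using assms orthonormal_finite finite_subset by blast
  have "cinner (\<Sum>f\<in>F. a f *s f) (\<Sum>g\<in>F. c g *s g)
      = (\<Sum>f\<in>F. cnj (a f) * cinner f (\<Sum>g\<in>F. c g *s g))"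
    by (simp add: cinner_sum_left cinner_scale_left)
  also have "\<dots> = (\<Sum>f\<in>F. cnj (a f) * c f)"
    using cinner_orthonormal_sum[OF assms(1) _ assms(2) fin] assms(2) by (intro sum.cong) auto
  finally show ?thesis .
qed

lemma norm_orthonormal_sum:
  assumes "orthonormal B" "F \<subseteq> B"
  shows "(norm (\<Sum>u\<in>F. c u *s u))\<^sup>2 = (\<Sum>u\<in>F. (cmod (c u))\<^sup>2)"
  using arg_cong[OF cinner_sum_orthonormal_sum[OF assms, of c c], of Re]
  by (simp add: cnj_mult_self)

lemma cinner_orth_residual:
  assumes "orthonormal F" "f \<in> F"
  shows "cinner f (orth_residual F v) = 0"
  using cinner_orthonormal_sum[OF assms(1,2) order_refl orthonormal_finite[OF assms(1)]] assms(2)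
  by (simp add: orth_residual_def cinner_diff_right)

lemma pythagoras_orthonormal:
  assumes "orthonormal F"
  shows "(norm v)\<^sup>2 = (\<Sum>f\<in>F. (cmod (cinner f v))\<^sup>2) + (norm (orth_residual F v))\<^sup>2"
proof -
  let ?p = "\<Sum>f\<in>F. cinner f v *s f" and ?r = "orth_residual F v"
  have pr: "cinner ?p ?r = 0"
    by (simp add: cinner_sum_left cinner_scale_left cinner_orth_residual[OF assms])
  have "(norm v)\<^sup>2 = Re (cinner (?p + ?r) (?p + ?r))"
    by (simp add: orth_residual_def)
  also have "\<dots> = (norm ?p)\<^sup>2 + (norm ?r)\<^sup>2"
    using pr cinner_commute[of ?r ?p] by (simp add: cinner_add_left cinner_add_right)
  finally show ?thesis
    using norm_orthonormal_sum[OF assms order_refl] by simp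
qed

lemma bessel_inequality:
  "orthonormal F \<Longrightarrow> (\<Sum>f\<in>F. (cmod (cinner f v))\<^sup>2) \<le> (norm v)\<^sup>2"
  using pythagoras_orthonormal[of F v] by simp

lemma orthonormal_basis_expansion:
  "orthonormal_basis B \<Longrightarrow> (\<Sum>u\<in>B. cinner u v *s u) = v"
  by (simp add: orthonormal_basis_def orth_residual_def)

lemma parseval:
  "orthonormal_basis B \<Longrightarrow> (\<Sum>u\<in>B. (cmod (cinner u v))\<^sup>2) = (norm v)\<^sup>2"
  using pythagoras_orthonormal[of B v] by (simp add: orthonormal_basis_def)

lemma orthonormal_insert_normalized_residual:
  assumes F: "orthonormal F" and r: "orth_residual F v \<noteq> 0"
  defines "w \<equiv> complex_of_real (1 / norm (orth_residual F v)) *s orth_residual F v"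
  shows "orthonormal (insert w F)" "w \<notin> F"
    and "(cmod (cinner w v))\<^sup>2 = (norm v)\<^sup>2 - (\<Sum>g\<in>F. (cmod (cinner g v))\<^sup>2)"
proof -
  let ?r = "orth_residual F v"
  have perp: "\<forall>u\<in>F. cinner u w = 0"
    using cinner_orth_residual[OF F] by (simp add: w_def cinner_scale_right)
  have nw: "norm w = 1"
    using r by (simp add: w_def norm_smult norm_divide)
  show "orthonormal (insert w F)" "w \<notin> F"
    using orthonormal_insert[OF F nw perp] by auto
  have "cinner ?r f = 0" if "f \<in> F" for f
    using cinner_orth_residual[OF F that] cinner_commute[of ?r f] by simp
  then have "cinner ?r (\<Sum>f\<in>F. cinner f v *s f) = 0"
    by (simp add: cinner_sum_right cinner_scale_right)
  moreover have "cinner ?r v = cinner ?r ?r + cinner ?r (\<Sum>f\<in>F. cinner f v *s f)"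
    by (simp add: orth_residual_def flip: cinner_add_right)
  ultimately have "cinner ?r v = cinner ?r ?r"
    by simp
  then have "cinner w v = complex_of_real (norm ?r)"
    using r by (simp add: w_def cinner_scale_left cinner_self power2_eq_square)
  then show "(cmod (cinner w v))\<^sup>2 = (norm v)\<^sup>2 - (\<Sum>g\<in>F. (cmod (cinner g v))\<^sup>2)"
    using pythagoras_orthonormal[OF F, of v] by simp
qed

section \<open>The spectral theorem and spectral projections\<close>

definition hermitian :: "complex^'n^'n \<Rightarrow> bool" where
  "hermitian A \<longleftrightarrow> adj A = A"

definition eigenbasis :: "complex^'n^'n \<Rightarrow> (complex^'n) set \<Rightarrow> (complex^'n \<Rightarrow> real) \<Rightarrow> bool" where
  "eigenbasis A B lam \<longleftrightarrow>
     orthonormal_basis B \<and> (\<forall>u\<in>B. A *v u = complex_of_real (lam u) *s u)"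

lemma hermitian_cinner:
  assumes "hermitian A"
  shows "cinner x (A *v y) = cnj (cinner y (A *v x))"
proof -
  have "cinner x (A *v y) = cinner (A *v x) y"
    using cinner_adj[of x A y] assms by (simp add: hermitian_def)
  then show ?thesis
    by (simp add: cinner_commute[of "A *v x" y])
qed

lemma hermitian_mat_1: "hermitian (mat 1)"
  by (simp add: hermitian_def adj_def mat_def vec_eq_iff)

lemma adj_scaleR: "adj (r *\<^sub>R A) = r *\<^sub>R adj A"
  by (simp add: adj_def vec_eq_iff)

lemma hermitian_sum_scaleR_outer: "hermitian (\<Sum>x\<in>S. r x *\<^sub>R outer (v x) (v x))"
  by (simp add: hermitian_def adj_sum adj_scaleR adj_outer_self)

lemma nonpos_quadratic_imp_linear_coeff_0:
  fixes a b :: real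
  assumes "\<And>t. 2 * t * a + t\<^sup>2 * b \<le> 0"
  shows "a = 0"
proof -
  define s where "s = 1 + \<bar>b\<bar>"
  have "s > 0" "2 * s + b > 0"
    by (auto simp: s_def)
  then have "s\<^sup>2 * (2 * (a / s) * a + (a / s)\<^sup>2 * b) = a\<^sup>2 * (2 * s + b)"
    by (simp add: power2_eq_square field_simps)
  moreover have "s\<^sup>2 * (2 * (a / s) * a + (a / s)\<^sup>2 * b) \<le> 0"
    using assms[of "a / s"] by (simp add: mult_nonneg_nonpos)
  ultimately have "a\<^sup>2 \<le> 0"
    using \<open>2 * s + b > 0\<close> by (metis mult_le_0_iff not_less)
  then show ?thesis
    by simp
qed

text \<open>Moving from a maximiser \<open>w\<close> of the Rayleigh quotient in the direction of its
  defect \<open>A w - \<lambda> w\<close> would increase the quotient to first order unless the defect vanishes.\<close>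

lemma rayleigh_maximizer_eigenvector:
  fixes A :: "complex^'n^'n"
  assumes herm: "hermitian A"
    and U: "\<And>x y. x \<in> U \<Longrightarrow> y \<in> U \<Longrightarrow> x + y \<in> U" "\<And>a x. x \<in> U \<Longrightarrow> a *s x \<in> U"
      "\<And>x. x \<in> U \<Longrightarrow> A *v x \<in> U"
    and w: "w \<in> U" "norm w = 1"
    and max: "\<And>x. x \<in> U \<Longrightarrow> Re (cinner x (A *v x)) \<le> Re (cinner w (A *v w)) * (norm x)\<^sup>2"
  shows "A *v w = complex_of_real (Re (cinner w (A *v w))) *s w"
proof -
  define lam where "lam = Re (cinner w (A *v w))"
  define g where "g y = A *v y - complex_of_real lam *s y" for y
  define h where "h x = Re (cinner x (g x))" for x
  define z where "z = g w"
  have "A *v w + (- complex_of_real lam) *s w \<in> U"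
    using U w by blast
  then have zU: "z \<in> U"
    by (simp add: z_def g_def vector_smult_lneg)
  have h_nonpos: "h x \<le> 0" if "x \<in> U" for x
    using max[OF that] by (simp add: h_def g_def lam_def cinner_diff_right cinner_scale_right)
  have g_lin: "g (x + complex_of_real t *s y) = g x + complex_of_real t *s g y" for x y t
    by (simp add: g_def matrix_vector_right_distrib matrix_vector_mult_smult algebra_simps
        vector_add_ldistrib vector_ssub_ldistrib vector_smult_assoc mult.commute)
  have h_expand: "h (x + complex_of_real t *s y)
      = h x + t * (Re (cinner x (g y)) + Re (cinner y (g x))) + t\<^sup>2 * h y" for x y t
    by (simp add: h_def g_lin cinner_add_left cinner_add_right cinner_scale_left
        cinner_scale_right power2_eq_square algebra_simps)
  have "h w = 0"
    using w(2) by (simp add: h_def g_def lam_def cinner_diff_right cinner_scale_right cinner_self)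
  moreover have "Re (cinner w (g z)) = Re (cinner z (g w))"
    using hermitian_cinner[OF herm, of w z]
    by (simp add: g_def cinner_diff_right cinner_scale_right cinner_commute[of w z])
  moreover have "Re (cinner z (g w)) = (norm z)\<^sup>2"
    by (simp add: z_def)
  ultimately have "h (w + complex_of_real t *s z) = 2 * t * (norm z)\<^sup>2 + t\<^sup>2 * h z" for t
    by (simp add: h_expand)
  then have "2 * t * (norm z)\<^sup>2 + t\<^sup>2 * h z \<le> 0" for t
    using h_nonpos U(1,2) w(1) zU by metis
  then have "z = 0"
    using nonpos_quadratic_imp_linear_coeff_0 by fastforce
  then show ?thesis
    by (simp add: z_def g_def lam_def)
qed

lemma exists_rayleigh_maximizer:
  fixes A :: "complex^'n^'n"
  assumes "closed U" and U_scale: "\<And>a x. x \<in> U \<Longrightarrow> a *s x \<in> U" and "r \<in> U" "r \<noteq> 0"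
  shows "\<exists>w\<in>U. norm w = 1 \<and>
    (\<forall>x\<in>U. Re (cinner x (A *v x)) \<le> Re (cinner w (A *v w)) * (norm x)\<^sup>2)"
proof -
  define K where "K = sphere (0::complex^'n) 1 \<inter> U"
  have "compact K"
    unfolding K_def using \<open>closed U\<close> by (rule compact_Int_closed[OF compact_sphere])
  have normalize: "complex_of_real (1 / norm x) *s x \<in> K" if "x \<in> U" "x \<noteq> 0" for x
    using that by (simp add: K_def U_scale norm_smult norm_divide)
  then have "K \<noteq> {}"
    using assms(3,4) by blast
  define f where "f v = Re (cinner v (A *v v))" for v
  have "continuous_on K f"
    unfolding f_def cinner_def by (intro continuous_intros matrix_vector_mult_linear_continuous_on)
  then obtain w where wK: "w \<in> K" and wmax: "\<forall>y\<in>K. f y \<le> f w"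
    using continuous_attains_sup[OF \<open>compact K\<close> \<open>K \<noteq> {}\<close>] by blast
  have "f x \<le> f w * (norm x)\<^sup>2" if "x \<in> U" for x
  proof (cases "x = 0")
    case False
    have "f x = (norm x)\<^sup>2 * f (complex_of_real (1 / norm x) *s x)"
      using False by (simp add: f_def matrix_vector_mult_smult cinner_scale_left cinner_scale_right
          power2_eq_square)
    also have "\<dots> \<le> (norm x)\<^sup>2 * f w"
      using wmax normalize[OF that False] by (intro mult_left_mono) auto
    finally show ?thesis
      by (simp add: mult.commute)
  qed (simp add: f_def)
  then show ?thesis
    using wK by (auto simp: K_def f_def)
qed

lemma hermitian_eigenvector_orthogonal:
  fixes A :: "complex^'n^'n"
  assumes herm: "hermitian A" and r: "\<forall>u\<in>B. cinner u r = 0" "r \<noteq> 0"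
    and eig: "\<forall>u\<in>B. \<exists>l::real. A *v u = complex_of_real l *s u"
  shows "\<exists>w. (\<forall>u\<in>B. cinner u w = 0) \<and> norm w = 1 \<and> (\<exists>l::real. A *v w = complex_of_real l *s w)"
proof -
  define U where "U = {v. \<forall>u\<in>B. cinner u v = 0}"
  have U_add: "x + y \<in> U" if "x \<in> U" "y \<in> U" for x y
    using that by (simp add: U_def cinner_add_right)
  have U_scale: "a *s x \<in> U" if "x \<in> U" for a x
    using that by (simp add: U_def cinner_scale_right)
  have U_inv: "A *v x \<in> U" if "x \<in> U" for x
  proof -
    have "cinner u (A *v x) = 0" if "u \<in> B" for u
    proof -
      obtain l :: real where l: "A *v u = complex_of_real l *s u"
        using eig \<open>u \<in> B\<close> by blast
      have "cinner u (A *v x) = complex_of_real l * cnj (cinner x u)"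
        using hermitian_cinner[OF herm, of u x] by (simp add: l cinner_scale_right)
      then show ?thesis
        using \<open>x \<in> U\<close> \<open>u \<in> B\<close> by (simp add: U_def cinner_commute[of x u])
    qed
    then show ?thesis
      by (simp add: U_def)
  qed
  have "closed {v. cinner u v = 0}" for u :: "complex^'n"
    unfolding cinner_def by (intro closed_Collect_eq continuous_intros)
  then have "closed U"
    by (auto simp: U_def Collect_ball_eq intro!: closed_INT)
  moreover have "r \<in> U"
    using r by (simp add: U_def)
  ultimately obtain w where "w \<in> U" "norm w = 1"
    "\<forall>x\<in>U. Re (cinner x (A *v x)) \<le> Re (cinner w (A *v w)) * (norm x)\<^sup>2"
    using exists_rayleigh_maximizer[OF _ U_scale _ r(2), where A = A] by blast
  then show ?thesis
    using rayleigh_maximizer_eigenvector[OF herm U_add U_scale U_inv, of w] by (auto simp: U_def)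
qed

text \<open>A maximal orthonormal set of eigenvectors spans: otherwise the previous lemma would
  extend it.\<close>

theorem hermitian_eigenbasis:
  fixes A :: "complex^'n^'n"
  assumes herm: "hermitian A"
  shows "\<exists>B lam. eigenbasis A B lam"
proof -
  define P where "P B \<longleftrightarrow> orthonormal B \<and> (\<forall>u\<in>B. \<exists>l::real. A *v u = complex_of_real l *s u)"
    for B :: "(complex^'n) set"
  have "P {}"
    by (simp add: P_def orthonormal_def)
  moreover have "\<forall>B. P B \<longrightarrow> card B < CARD('n) + 1"
    using card_orthonormal_le by (auto simp: P_def less_Suc_eq_le)
  ultimately obtain B where PB: "P B" and B_max: "\<And>C. P C \<Longrightarrow> card C \<le> card B"
    using ex_has_greatest_nat[of P "{}" card "CARD('n) + 1"] by blast
  have on: "orthonormal B"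
    using PB by (simp add: P_def)
  have "orth_residual B v = 0" for v
  proof (rule ccontr)
    assume "orth_residual B v \<noteq> 0"
    then obtain w where w: "\<forall>u\<in>B. cinner u w = 0" "norm w = 1"
      "\<exists>l::real. A *v w = complex_of_real l *s w"
      using hermitian_eigenvector_orthogonal[OF herm, of B "orth_residual B v"]
        cinner_orth_residual[OF on] PB by (auto simp: P_def)
    then have "P (insert w B)" "w \<notin> B"
      using orthonormal_insert[OF on] PB by (auto simp: P_def)
    then show False
      using B_max[of "insert w B"] orthonormal_finite[OF on] by simp
  qed
  moreover obtain lam where "\<forall>u\<in>B. A *v u = complex_of_real (lam u) *s u"
    using bchoice[of B "\<lambda>u l. A *v u = complex_of_real l *s u"] PB by (auto simp: P_def)
  ultimately show ?thesis
    using on by (auto simp: eigenbasis_def orthonormal_basis_def)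
qed

lemma orthonormal_basis_exists: "\<exists>B :: (complex^'n) set. orthonormal_basis B"
  using hermitian_eigenbasis[OF hermitian_mat_1] by (auto simp: eigenbasis_def)

definition proj_onto :: "(complex^'n) set \<Rightarrow> complex^'n^'n" where
  "proj_onto S = (\<Sum>u\<in>S. outer u u)"

lemma proj_onto_mult_vec: "proj_onto S *v v = (\<Sum>u\<in>S. cinner u v *s u)"
  by (simp add: proj_onto_def matrix_vector_mult_sum_rdistrib outer_mult_vec)

lemma cinner_proj_onto: "cinner v (proj_onto S *v v) = complex_of_real (\<Sum>u\<in>S. (cmod (cinner u v))\<^sup>2)"
  by (simp add: proj_onto_def matrix_vector_mult_sum_rdistrib cinner_sum_right cinner_outer_self)

lemma adj_proj_onto: "adj (proj_onto S) = proj_onto S"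
  by (simp add: proj_onto_def adj_sum adj_outer_self)

lemma proj_onto_idem:
  assumes "orthonormal S"
  shows "proj_onto S ** proj_onto S = proj_onto S"
proof -
  have "proj_onto S *v (proj_onto S *v v) = proj_onto S *v v" for v
    using cinner_orthonormal_sum[OF assms _ order_refl orthonormal_finite[OF assms]]
    by (simp add: proj_onto_mult_vec cong: sum.cong)
  then show ?thesis
    by (simp add: matrix_eq matrix_vector_mul_assoc)
qed

lemma trace_mult_proj_onto: "trace (A ** proj_onto S) = (\<Sum>u\<in>S. cinner u (A *v u))"
  by (simp add: proj_onto_def trace_mult_sum_right trace_mult_outer)

lemma orthogonal_projection_unique:
  fixes P Q :: "complex^'n^'n"
  assumes "adj P = P" "P ** P = P" "adj Q = Q" "Q ** Q = Q"
    and "range ((*v) P) = range ((*v) Q)"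
  shows "P = Q"
proof -
  have orth: "cinner y (v - M *v v) = 0"
    if M: "adj M = M" "M ** M = M" "y \<in> range ((*v) M)" for M :: "complex^'n^'n" and y v
  proof -
    obtain w where "y = M *v w"
      using M(3) by blast
    then have "cinner y (v - M *v v) = cinner w (M *v (v - M *v v))"
      by (simp add: cinner_adj M(1))
    also have "\<dots> = 0"
      by (simp add: matrix_vector_mult_diff_distrib matrix_vector_mul_assoc M(2))
    finally show ?thesis .
  qed
  have "P *v v = Q *v v" for v
  proof -
    define d where "d = P *v v - Q *v v"
    obtain w where "Q *v v = P *v w"
      using assms(5) by (metis rangeE rangeI)
    then have dP: "d \<in> range ((*v) P)"
      by (simp add: d_def matrix_vector_mult_diff_distrib[symmetric])
    then have dQ: "d \<in> range ((*v) Q)"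
      using assms(5) by simp
    have "cinner d d = cinner d (v - Q *v v) - cinner d (v - P *v v)"
      by (simp add: d_def cinner_diff_right)
    also have "\<dots> = 0"
      using orth[OF assms(1,2) dP] orth[OF assms(3,4) dQ] by simp
    finally show ?thesis
      by (simp add: cinner_self d_def)
  qed
  then show ?thesis
    by (simp add: matrix_eq)
qed

lemma range_idempotent:
  fixes P :: "'a::semiring_1^'n^'n"
  assumes "P ** P = P"
  shows "range ((*v) P) = {v. P *v v = v}"
proof
  show "range ((*v) P) \<subseteq> {v. P *v v = v}"
    using assms by (auto simp: matrix_vector_mul_assoc)
  show "{v. P *v v = v} \<subseteq> range ((*v) P)"
    by (metis (mono_tags) mem_Collect_eq range_eqI subsetI)
qed

lemma proj_onto_eigenvector:
  assumes herm: "hermitian A" and eb: "eigenbasis A B lam"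
    and v: "A *v v = complex_of_real mu *s v" and "c \<le> mu"
  shows "proj_onto {u\<in>B. c \<le> lam u} *v v = v"
proof -
  have onb: "orthonormal_basis B" and eig: "\<forall>u\<in>B. A *v u = complex_of_real (lam u) *s u"
    using eb by (auto simp: eigenbasis_def)
  have "cinner u v = 0" if "u \<in> B" "lam u < c" for u
  proof -
    have "complex_of_real mu * cinner u v = complex_of_real (lam u) * cinner u v"
      using hermitian_cinner[OF herm, of u v] eig that(1)
      by (simp add: v cinner_scale_right cinner_commute[of u v])
    moreover have "mu \<noteq> lam u"
      using that \<open>c \<le> mu\<close> by auto
    ultimately show ?thesis
      by simp
  qed
  then have "proj_onto {u\<in>B. c \<le> lam u} *v v = (\<Sum>u\<in>B. cinner u v *s u)"
    unfolding proj_onto_mult_vec using orthonormal_finite onb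
    by (intro sum.mono_neutral_left) (auto simp: orthonormal_basis_def not_le)
  then show ?thesis
    using orthonormal_basis_expansion[OF onb] by simp
qed

lemma proj_ge_eigenbasis:
  fixes A :: "complex^'n^'n"
  assumes herm: "hermitian A" and eb: "eigenbasis A B lam"
  shows "proj_ge A c = proj_onto {u\<in>B. c \<le> lam u}"
proof -
  define S where "S = {u\<in>B. c \<le> lam u}"
  define P where "P = proj_onto S"
  define E where "E = {v. \<exists>mu::real. mu \<ge> c \<and> A *v v = complex_of_real mu *s v}"
  have "orthonormal S"
    using eb orthonormal_subset[of B S] by (auto simp: eigenbasis_def orthonormal_basis_def S_def)
  then have idem: "P ** P = P"
    using proj_onto_idem by (simp add: P_def)
  have "E \<subseteq> {v. P *v v = v}"
    using proj_onto_eigenvector[OF herm eb] by (auto simp: E_def P_def S_def)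
  moreover have "vec.subspace {v. P *v v = v}"
    by (auto simp: vec.subspace_def matrix_vector_right_distrib matrix_vector_mult_smult)
  ultimately have "vec.span E \<subseteq> range ((*v) P)"
    using vec.span_minimal range_idempotent[OF idem] by simp
  moreover have "range ((*v) P) \<subseteq> vec.span E"
  proof
    fix y assume "y \<in> range ((*v) P)"
    then obtain v where "y = (\<Sum>u\<in>S. cinner u v *s u)"
      by (auto simp: P_def proj_onto_mult_vec)
    moreover have "S \<subseteq> E"
      using eb by (auto simp: S_def E_def eigenbasis_def)
    ultimately show "y \<in> vec.span E"
      by (auto intro!: vec.span_sum vec.span_scale intro: vec.span_base)
  qed
  ultimately have "range ((*v) P) = vec.span E"
    by blast
  then have "proj_ge A c = P"
    unfolding proj_ge_def E_def
    using orthogonal_projection_unique[of _ P] idem by (intro the_equality) (auto simp: P_def adj_proj_onto)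
  then show ?thesis
    by (simp add: P_def S_def)
qed

lemma trace_mult_proj_ge:
  assumes "hermitian A" "eigenbasis A B lam"
  shows "Re (trace (A ** proj_ge A c)) = (\<Sum>u\<in>{u\<in>B. c \<le> lam u}. lam u)"
proof -
  have "u \<in> B \<Longrightarrow> cinner u (A *v u) = complex_of_real (lam u)" for u
    using assms(2) orthonormalD[of B u u]
    by (simp add: eigenbasis_def orthonormal_basis_def cinner_scale_right)
  then show ?thesis
    by (simp add: proj_ge_eigenbasis[OF assms] trace_mult_proj_onto)
qed

section \<open>Quadratic forms of positive semidefinite matrices\<close>

definition qform :: "complex^'n^'n \<Rightarrow> complex^'n \<Rightarrow> real" where
  "qform Q v = Re (cinner v (Q *v v))"

lemma qform_nonneg: "psd Q \<Longrightarrow> 0 \<le> qform Q v"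
  unfolding psd_def qform_def by (metis Re_complex_of_real)

lemma qform_smult: "qform Q (a *s v) = (cmod a)\<^sup>2 * qform Q v"
proof -
  have "cinner (a *s v) (Q *v (a *s v)) = (cnj a * a) * cinner v (Q *v v)"
    by (simp add: matrix_vector_mult_smult cinner_scale_left cinner_scale_right)
  then show ?thesis
    by (simp add: qform_def cnj_mult_self)
qed

lemma qform_sum_matrix: "qform (sum Q S) v = (\<Sum>j\<in>S. qform (Q j) v)"
  by (simp add: qform_def matrix_vector_mult_sum_rdistrib cinner_sum_right)

lemma qform_scaleR: "qform (r *\<^sub>R Q) v = r * qform Q v"
  by (simp add: qform_def matrix_vector_mult_scaleR_left cinner_scale_right)

lemma qform_mat_1: "qform (mat 1) v = (norm v)\<^sup>2"
  by (simp add: qform_def)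

lemma psd_mat_1: "psd (mat 1)"
  unfolding psd_def by (metis cinner_self matrix_vector_mul_lid zero_le_power2)

lemma qform_outer_self: "qform (outer u u) v = (cmod (cinner u v))\<^sup>2"
  by (simp add: qform_def cinner_outer_self)

lemma qform_add_weighted:
  "t * qform Q (y + z) + qform Q (complex_of_real t *s y - z)
     = (1 + t) * (t * qform Q y + qform Q z)"
proof -
  let ?c = "Re (cinner y (Q *v z)) + Re (cinner z (Q *v y))"
  have "qform Q (y + z) = qform Q y + qform Q z + ?c"
    by (simp add: qform_def matrix_vector_right_distrib cinner_add_left cinner_add_right)
  moreover have "qform Q (complex_of_real t *s y - z) = t\<^sup>2 * qform Q y + qform Q z - t * ?c"
    by (simp add: qform_def matrix_vector_mult_diff_distrib matrix_vector_mult_smult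
        cinner_diff_left cinner_diff_right cinner_scale_left cinner_scale_right power2_eq_square
        algebra_simps)
  ultimately show ?thesis
    by (simp add: algebra_simps power2_eq_square)
qed

lemma qform_add_le:
  assumes "psd Q" "t > 0"
  shows "qform Q (y + z) \<le> (1 + t) * qform Q y + (1 + 1 / t) * qform Q z"
proof -
  have "t * qform Q (y + z) \<le> (1 + t) * (t * qform Q y + qform Q z)"
    using qform_add_weighted[of t Q y z] qform_nonneg[OF assms(1), of "complex_of_real t *s y - z"]
    by linarith
  then show ?thesis
    using assms(2) by (simp add: field_simps)
qed

lemma le_sqrt_add_square_if_le_weighted:
  fixes x a b :: real
  assumes a: "a \<ge> 0" and b: "b \<ge> 0"
    and le: "\<And>t. t > 0 \<Longrightarrow> x \<le> (1 + t) * a + (1 + 1 / t) * b"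
  shows "x \<le> (sqrt a + sqrt b)\<^sup>2"
proof (cases "a = 0 \<or> b = 0")
  case True
  have "x \<le> a + b + e" if "e > 0" for e
  proof (cases "a = 0")
    case True
    have "x \<le> b + b / ((b + 1) / e)"
      using le[of "(b + 1) / e"] True that b by (simp add: algebra_simps)
    moreover have "b / ((b + 1) / e) \<le> e"
      using that b by (simp add: field_simps)
    ultimately show ?thesis
      using True by simp
  next
    case False
    with \<open>a = 0 \<or> b = 0\<close> have "b = 0"
      by simp
    have "x \<le> a + e / (a + 1) * a"
      using le[of "e / (a + 1)"] \<open>b = 0\<close> that a by (simp add: algebra_simps)
    moreover have "e / (a + 1) * a \<le> e"
      using that a by (simp add: field_simps)
    ultimately show ?thesis
      using \<open>b = 0\<close> by simp
  qed
  then have "x \<le> a + b"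
    by (rule field_le_epsilon)
  then show ?thesis
    using True a b by auto
next
  case False
  define s r where "s = sqrt a" and "r = sqrt b"
  have "s > 0" "r > 0" "a = s\<^sup>2" "b = r\<^sup>2"
    using False a b by (auto simp: s_def r_def)
  then have "(1 + r / s) * a + (1 + 1 / (r / s)) * b = (s + r)\<^sup>2"
    by (simp add: field_simps power2_eq_square)
  then show ?thesis
    using le[of "r / s"] \<open>s > 0\<close> \<open>r > 0\<close> by (simp add: s_def r_def)
qed

lemma sqrt_qform_add_le:
  assumes "psd Q"
  shows "sqrt (qform Q (y + z)) \<le> sqrt (qform Q y) + sqrt (qform Q z)"
proof -
  have "qform Q (y + z) \<le> (sqrt (qform Q y) + sqrt (qform Q z))\<^sup>2"
    using qform_add_le[OF assms] qform_nonneg[OF assms]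
    by (intro le_sqrt_add_square_if_le_weighted) auto
  then show ?thesis
    using qform_nonneg[OF assms] by (simp add: real_le_lsqrt)
qed

lemma sqrt_qform_sum_le:
  assumes "psd Q"
  shows "sqrt (qform Q (sum y S)) \<le> (\<Sum>u\<in>S. sqrt (qform Q (y u)))"
proof (induction S rule: infinite_finite_induct)
  case (insert x F)
  then show ?case
    using sqrt_qform_add_le[OF assms, of "y x" "sum y F"] by simp
qed (auto simp: qform_def)

lemma qform_lincomb_le:
  assumes "psd Q"
  shows "qform Q (\<Sum>u\<in>S. c u *s u) \<le> (\<Sum>u\<in>S. (cmod (c u))\<^sup>2) * (\<Sum>u\<in>S. qform Q u)"
proof -
  have nonneg: "0 \<le> qform Q v" for v
    using qform_nonneg[OF assms] .
  have "sqrt (qform Q (\<Sum>u\<in>S. c u *s u)) \<le> (\<Sum>u\<in>S. cmod (c u) * sqrt (qform Q u))"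
    using sqrt_qform_sum_le[OF assms, of "\<lambda>u. c u *s u" S] by (simp add: qform_smult real_sqrt_mult)
  then have "qform Q (\<Sum>u\<in>S. c u *s u) \<le> (\<Sum>u\<in>S. cmod (c u) * sqrt (qform Q u))\<^sup>2"
    by (rule sqrt_le_D)
  also have "\<dots> \<le> (\<Sum>u\<in>S. (cmod (c u))\<^sup>2) * (\<Sum>u\<in>S. (sqrt (qform Q u))\<^sup>2)"
    by (rule Cauchy_Schwarz_ineq_sum)
  finally show ?thesis
    using nonneg by simp
qed

lemma qform_le_norm_povm:
  assumes "povm N Q" "i < N"
  shows "qform (Q i) v \<le> (norm v)\<^sup>2"
proof -
  have "qform (Q i) v \<le> (\<Sum>j<N. qform (Q j) v)"
    using assms qform_nonneg by (intro member_le_sum) (auto simp: povm_def)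
  also have "\<dots> = (norm v)\<^sup>2"
    using assms(1) by (simp add: povm_def qform_mat_1 flip: qform_sum_matrix)
  finally show ?thesis .
qed

lemma qform_povm_sum_basis:
  assumes "povm N Q" "orthonormal S"
  shows "(\<Sum>u\<in>S. \<Sum>i<N. qform (Q i) u) = card S"
  using assms orthonormal_norm[OF assms(2)]
  by (simp add: povm_def qform_mat_1 flip: qform_sum_matrix)

text \<open>Each term is at most the trace of \<open>Q i\<close>, and the traces add up to the dimension.\<close>

lemma povm_success_le_dim:
  fixes Q :: "nat \<Rightarrow> complex^'n^'n"
  assumes povm: "povm N Q" and unit: "\<And>i. i < N \<Longrightarrow> norm (v i) = 1"
  shows "(\<Sum>i<N. qform (Q i) (v i)) \<le> CARD('n)"
proof -
  obtain B :: "(complex^'n) set" where B: "orthonormal_basis B"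
    using orthonormal_basis_exists by blast
  then have on: "orthonormal B"
    by (simp add: orthonormal_basis_def)
  have "qform (Q i) (v i) \<le> (\<Sum>u\<in>B. qform (Q i) u)" if "i < N" for i
  proof -
    have "qform (Q i) (v i) = qform (Q i) (\<Sum>u\<in>B. cinner u (v i) *s u)"
      using orthonormal_basis_expansion[OF B] by simp
    also have "\<dots> \<le> (\<Sum>u\<in>B. (cmod (cinner u (v i)))\<^sup>2) * (\<Sum>u\<in>B. qform (Q i) u)"
      using povm that by (intro qform_lincomb_le) (simp add: povm_def)
    finally show ?thesis
      using parseval[OF B] unit[OF that] by simp
  qed
  then have "(\<Sum>i<N. qform (Q i) (v i)) \<le> (\<Sum>u\<in>B. \<Sum>i<N. qform (Q i) u)"
    by (subst sum.swap) (intro sum_mono, auto)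
  also have "\<dots> = card B"
    using qform_povm_sum_basis[OF povm on] .
  also have "\<dots> \<le> CARD('n)"
    using card_orthonormal_le[OF on] by simp
  finally show ?thesis .
qed

section \<open>Ensembles of pure states\<close>

lemma Hs_le_ereal:
  assumes "\<And>lam. Re (trace (rho ** proj_ge rho (exp (- lam)))) \<le> e \<Longrightarrow> lam \<le> L"
  shows "Hs e rho \<le> ereal L"
  unfolding Hs_def using assms by (auto intro!: Sup_least)

lemma ereal_le_Hs:
  assumes "Re (trace (rho ** proj_ge rho (exp (- lam)))) \<le> e"
  shows "ereal lam \<le> Hs e rho"
  unfolding Hs_def using assms by (auto intro!: Sup_upper)

lemma exists_le_expectation:
  assumes "finite X" "P \<in> distributions X"
  shows "\<exists>x\<in>X. g x \<le> (\<Sum>x\<in>X. P x * g x)"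
proof (rule ccontr)
  define E where "E = (\<Sum>x\<in>X. P x * g x)"
  assume "\<not> (\<exists>x\<in>X. g x \<le> (\<Sum>x\<in>X. P x * g x))"
  then have gt: "\<And>x. x \<in> X \<Longrightarrow> E < g x"
    by (auto simp: E_def not_le)
  have P: "\<And>x. x \<in> X \<Longrightarrow> 0 \<le> P x" "(\<Sum>x\<in>X. P x) = 1"
    using assms(2) by (auto simp: distributions_def)
  then obtain x0 where "x0 \<in> X" "P x0 > 0"
    by (metis less_eq_real_def sum.neutral zero_neq_one)
  then have "0 < (\<Sum>x\<in>X. P x * (g x - E))"
    using assms(1) P(1) gt by (intro sum_pos2[of X x0]) (auto simp: less_imp_le)
  also have "\<dots> = 0"
    using P(2) by (simp add: E_def right_diff_distrib sum_subtractf flip: sum_distrib_right)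
  finally show False
    by simp
qed

definition empirical :: "nat \<Rightarrow> (nat \<Rightarrow> 'x) \<Rightarrow> 'x \<Rightarrow> real" where
  "empirical N xs x = real (card {i. i < N \<and> xs i = x}) / real N"

lemma sum_empirical_mult:
  assumes "finite X" "\<forall>i<N. xs i \<in> X"
  shows "(\<Sum>x\<in>X. empirical N xs x * g x) = (\<Sum>i<N. g (xs i)) / real N"
proof -
  have "(\<Sum>i<N. g (xs i)) = (\<Sum>x\<in>X. \<Sum>i\<in>{i\<in>{..<N}. xs i = x}. g (xs i))"
    using assms by (intro sum.group[symmetric]) auto
  also have "\<dots> = (\<Sum>x\<in>X. real (card {i. i < N \<and> xs i = x}) * g x)"
    by (intro sum.cong) (auto simp: lessThan_def)
  finally show ?thesis
    by (simp add: empirical_def sum_divide_distrib)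
qed

lemma empirical_distribution:
  assumes "finite X" "\<forall>i<N. xs i \<in> X" "N > 0"
  shows "empirical N xs \<in> distributions X"
  using sum_empirical_mult[OF assms(1,2), of "\<lambda>_. 1"] assms(3)
  by (simp add: distributions_def empirical_def)

locale pure_family =
  fixes W :: "'x \<Rightarrow> complex^'n^'n" and X :: "'x set" and psi :: "'x \<Rightarrow> complex^'n"
  assumes finite_X: "finite X" and X_ne: "X \<noteq> {}"
    and norm_psi: "\<And>x. x \<in> X \<Longrightarrow> norm (psi x) = 1"
    and W_eq: "\<And>x. x \<in> X \<Longrightarrow> W x = outer (psi x) (psi x)"
begin

lemma error_eq: "x \<in> X \<Longrightarrow> Re (trace (W x ** (mat 1 - Q))) = 1 - qform Q (psi x)"
  by (simp add: W_eq norm_psi trace_outer_mult matrix_vector_mult_diff_rdistrib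
      cinner_diff_right qform_def)

lemma distinguishable_iff_success:
  assumes "N > 0"
  shows "distinguishable W X eps N \<longleftrightarrow>
    (\<exists>xs Q. (\<forall>i<N. xs i \<in> X) \<and> povm N Q \<and>
       real N * (1 - eps) \<le> (\<Sum>i<N. qform (Q i) (psi (xs i))))"
proof -
  have "(1 / real N) * (\<Sum>i<N. Re (trace (W (xs i) ** (mat 1 - Q i)))) \<le> eps \<longleftrightarrow>
      real N * (1 - eps) \<le> (\<Sum>i<N. qform (Q i) (psi (xs i)))"
    if "\<forall>i<N. xs i \<in> X" for xs Q
  proof -
    let ?err = "\<Sum>i<N. Re (trace (W (xs i) ** (mat 1 - Q i)))"
      and ?succ = "\<Sum>i<N. qform (Q i) (psi (xs i))"
    have "?err = real N - ?succ"
      using that by (simp add: error_eq sum_subtractf)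
    moreover have "(1 / real N) * ?err \<le> eps \<longleftrightarrow> ?err \<le> real N * eps"
      using assms by (simp add: field_simps)
    moreover have "real N * (1 - eps) \<le> ?succ \<longleftrightarrow> real N - ?succ \<le> real N * eps"
      by (simp add: algebra_simps)
    ultimately show ?thesis
      by simp
  qed
  then show ?thesis
    unfolding distinguishable_def by blast
qed

lemma distinguishable_1: "0 \<le> eps \<Longrightarrow> distinguishable W X eps 1"
  using X_ne unfolding distinguishable_def
  by (intro exI[of _ "\<lambda>_. SOME x. x \<in> X"] exI[of _ "\<lambda>_. mat 1"])
    (auto simp: povm_def psd_mat_1 trace_def some_in_eq)

lemma distinguishable_le_dim:
  assumes "distinguishable W X eps N"
  shows "real N * (1 - eps) \<le> CARD('n)"
proof (cases "N = 0")
  case False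
  then obtain xs Q where "\<forall>i<N. xs i \<in> X" "povm N Q"
    "real N * (1 - eps) \<le> (\<Sum>i<N. qform (Q i) (psi (xs i)))"
    using assms distinguishable_iff_success by auto
  then show ?thesis
    using povm_success_le_dim[of N Q "\<lambda>i. psi (xs i)"] norm_psi by fastforce
qed simp

lemma
  assumes "0 \<le> eps" "eps < 1"
  shows distinguishable_Mdist: "distinguishable W X eps (Mdist W X eps)"
    and le_Mdist: "distinguishable W X eps N \<Longrightarrow> N \<le> Mdist W X eps"
    and Mdist_ge_1: "1 \<le> Mdist W X eps"
proof -
  have bounded: "N \<le> nat \<lceil>CARD('n) / (1 - eps)\<rceil>" if "distinguishable W X eps N" for N
  proof -
    have "real N \<le> CARD('n) / (1 - eps)"
      using distinguishable_le_dim[OF that] assms by (simp add: field_simps)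
    then show ?thesis
      by linarith
  qed
  show "distinguishable W X eps (Mdist W X eps)"
    unfolding Mdist_def using distinguishable_1[OF assms(1)] bounded by (rule GreatestI_nat)
  show "N \<le> Mdist W X eps" if "distinguishable W X eps N"
    unfolding Mdist_def using that bounded by (rule Greatest_le_nat)
  show "1 \<le> Mdist W X eps"
    unfolding Mdist_def using distinguishable_1[OF assms(1)] bounded by (rule Greatest_le_nat)
qed

end

locale pure_ensemble = pure_family +
  fixes P :: "'x \<Rightarrow> real"
  assumes P_distribution: "P \<in> distributions X"
begin

lemma P_nonneg: "x \<in> X \<Longrightarrow> 0 \<le> P x" and sum_P: "(\<Sum>x\<in>X. P x) = 1"
  using P_distribution by (auto simp: distributions_def)

lemma mixture_eq: "mixture W X P = (\<Sum>x\<in>X. P x *\<^sub>R outer (psi x) (psi x))"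
  unfolding mixture_def by (intro sum.cong) (auto simp: W_eq)

lemma hermitian_mixture: "hermitian (mixture W X P)"
  by (simp add: mixture_eq hermitian_sum_scaleR_outer)

lemma qform_mixture: "qform (mixture W X P) f = (\<Sum>x\<in>X. P x * (cmod (cinner f (psi x)))\<^sup>2)"
  by (simp add: mixture_eq qform_sum_matrix qform_scaleR qform_outer_self
      cmod_cinner_commute[of "psi _" f])

lemma exists_eigenbasis: "\<exists>B lam. eigenbasis (mixture W X P) B lam"
  by (rule hermitian_eigenbasis[OF hermitian_mixture])

end

locale ensemble_eigenbasis = pure_ensemble +
  fixes B and lam :: "complex^'n \<Rightarrow> real"
  assumes eigenbasis: "eigenbasis (mixture W X P) B lam"
begin

lemma onb: "orthonormal_basis B" and on: "orthonormal B"
  and eigvec: "u \<in> B \<Longrightarrow> mixture W X P *v u = complex_of_real (lam u) *s u"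
  using eigenbasis by (auto simp: eigenbasis_def orthonormal_basis_def)

lemma finite_B: "finite B"
  using orthonormal_finite[OF on] .

lemma eigval_eq_qform: "u \<in> B \<Longrightarrow> lam u = qform (mixture W X P) u"
  using orthonormal_norm[OF on] by (simp add: qform_def eigvec cinner_scale_right)

lemma eigval_eq: "u \<in> B \<Longrightarrow> lam u = (\<Sum>x\<in>X. P x * (cmod (cinner u (psi x)))\<^sup>2)"
  by (simp add: eigval_eq_qform qform_mixture)

lemma eigval_nonneg: "u \<in> B \<Longrightarrow> 0 \<le> lam u"
  by (simp add: eigval_eq P_nonneg sum_nonneg)

lemma sum_eigval: "(\<Sum>u\<in>B. lam u) = 1"
proof -
  have "(\<Sum>u\<in>B. lam u) = (\<Sum>x\<in>X. P x * (\<Sum>u\<in>B. (cmod (cinner u (psi x)))\<^sup>2))"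
    by (simp add: eigval_eq sum_distrib_left sum.swap[of _ B])
  also have "\<dots> = 1"
    by (simp add: parseval[OF onb] norm_psi sum_P)
  finally show ?thesis .
qed

lemma qform_mixture_eigen: "qform (mixture W X P) f = (\<Sum>u\<in>B. lam u * (cmod (cinner u f))\<^sup>2)"
proof -
  have e: "(\<Sum>u\<in>B. cinner u f *s u) = f"
    by (rule orthonormal_basis_expansion[OF onb])
  have "mixture W X P *v f = (\<Sum>u\<in>B. cinner u f *s (mixture W X P *v u))"
    by (subst (1) e[symmetric]) (simp add: matrix_vector_mult_sum_distrib matrix_vector_mult_smult)
  also have "\<dots> = (\<Sum>u\<in>B. (complex_of_real (lam u) * cinner u f) *s u)"
    by (intro sum.cong) (simp_all add: eigvec vector_smult_assoc mult.commute)
  finally have mv: "mixture W X P *v f = \<dots>" .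
  have "cinner f (mixture W X P *v f) = (\<Sum>u\<in>B. cnj (cinner u f) * (complex_of_real (lam u) * cinner u f))"
    using cinner_sum_orthonormal_sum[OF on order_refl, of "\<lambda>u. cinner u f"
        "\<lambda>u. complex_of_real (lam u) * cinner u f"]
    unfolding e mv .
  then show ?thesis
    by (simp add: qform_def cnj_mult_self mult.left_commute[of "cnj _"])
qed

definition top_eigvecs :: "real \<Rightarrow> (complex^'n) set" where
  "top_eigvecs c = {u\<in>B. c \<le> lam u}"

definition top_weight :: "real \<Rightarrow> real" where
  "top_weight c = (\<Sum>u\<in>top_eigvecs c. lam u)"

lemma top_eigvecs_subset: "top_eigvecs c \<subseteq> B"
  by (auto simp: top_eigvecs_def)

lemma trace_proj_ge_mixture: "Re (trace (mixture W X P ** proj_ge (mixture W X P) c)) = top_weight c"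
  unfolding top_weight_def top_eigvecs_def
  by (rule trace_mult_proj_ge[OF hermitian_mixture eigenbasis])

lemma top_weight_le_1: "top_weight c \<le> 1"
proof -
  have "top_weight c \<le> (\<Sum>u\<in>B. lam u)"
    unfolding top_weight_def using top_eigvecs_subset finite_B eigval_nonneg
    by (intro sum_mono2) auto
  then show ?thesis
    by (simp add: sum_eigval)
qed

lemma card_top_eigvecs_le: "c * card (top_eigvecs c) \<le> top_weight c"
proof -
  have "c * card (top_eigvecs c) = (\<Sum>u\<in>top_eigvecs c. c)"
    by simp
  also have "\<dots> \<le> top_weight c"
    unfolding top_weight_def by (intro sum_mono) (auto simp: top_eigvecs_def)
  finally show ?thesis .
qed

lemma top_weight_eq_expectation:
  "top_weight c = (\<Sum>x\<in>X. P x * (\<Sum>u\<in>top_eigvecs c. (cmod (cinner u (psi x)))\<^sup>2))"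
  unfolding top_weight_def using top_eigvecs_subset
  by (simp add: eigval_eq subset_iff sum_distrib_left sum.swap[of _ "top_eigvecs c"])

lemma qform_mixture_le_top:
  assumes "norm f = 1" "c \<ge> 0"
  shows "qform (mixture W X P) f \<le> (\<Sum>u\<in>top_eigvecs c. lam u * (cmod (cinner u f))\<^sup>2) + c"
proof -
  let ?S = "top_eigvecs c"
  have "(\<Sum>u\<in>B - ?S. lam u * (cmod (cinner u f))\<^sup>2) \<le> (\<Sum>u\<in>B - ?S. c * (cmod (cinner u f))\<^sup>2)"
    by (intro sum_mono mult_right_mono) (auto simp: top_eigvecs_def)
  also have "\<dots> \<le> c"
    using bessel_inequality[OF orthonormal_subset[OF on], of "B - ?S" f] assms
    by (simp add: mult_left_le flip: sum_distrib_left)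
  moreover have "qform (mixture W X P) f = (\<Sum>u\<in>B - ?S. lam u * (cmod (cinner u f))\<^sup>2)
      + (\<Sum>u\<in>?S. lam u * (cmod (cinner u f))\<^sup>2)"
    unfolding qform_mixture_eigen by (rule sum.subset_diff[OF top_eigvecs_subset finite_B])
  ultimately show ?thesis
    by linarith
qed

lemma expected_overlap_le:
  assumes F: "orthonormal F" and "c \<ge> 0"
  shows "(\<Sum>x\<in>X. P x * (\<Sum>f\<in>F. (cmod (cinner f (psi x)))\<^sup>2)) \<le> top_weight c + c * card F"
proof -
  let ?S = "top_eigvecs c"
  have "(\<Sum>x\<in>X. P x * (\<Sum>f\<in>F. (cmod (cinner f (psi x)))\<^sup>2)) = (\<Sum>f\<in>F. qform (mixture W X P) f)"
    by (simp add: qform_mixture sum_distrib_left sum.swap[of _ F])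
  also have "\<dots> \<le> (\<Sum>f\<in>F. (\<Sum>u\<in>?S. lam u * (cmod (cinner u f))\<^sup>2) + c)"
    using qform_mixture_le_top orthonormal_norm[OF F] assms(2) by (intro sum_mono) auto
  also have "\<dots> = (\<Sum>u\<in>?S. lam u * (\<Sum>f\<in>F. (cmod (cinner f u))\<^sup>2)) + c * card F"
    by (simp add: sum.distrib sum_distrib_left sum.swap[of _ F] cmod_cinner_commute[of _ "u" for u])
  also have "\<dots> \<le> (\<Sum>u\<in>?S. lam u * 1) + c * card F"
  proof -
    have "lam u * (\<Sum>f\<in>F. (cmod (cinner f u))\<^sup>2) \<le> lam u * 1" if "u \<in> ?S" for u
    proof -
      have "u \<in> B"
        using that top_eigvecs_subset by blast
      then show ?thesis
        using bessel_inequality[OF F, of u] orthonormal_norm[OF on] eigval_nonneg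
        by (intro mult_left_mono) auto
    qed
    then show ?thesis
      by (intro add_right_mono sum_mono)
  qed
  finally show ?thesis
    by (simp add: top_weight_def)
qed

lemma exists_small_overlap:
  assumes "orthonormal F" "c \<ge> 0"
  shows "\<exists>x\<in>X. (\<Sum>f\<in>F. (cmod (cinner f (psi x)))\<^sup>2) \<le> top_weight c + c * card F"
proof -
  obtain x where "x \<in> X" and le:
    "(\<Sum>f\<in>F. (cmod (cinner f (psi x)))\<^sup>2) \<le> (\<Sum>x\<in>X. P x * (\<Sum>f\<in>F. (cmod (cinner f (psi x)))\<^sup>2))"
    using exists_le_expectation[OF finite_X P_distribution,
        of "\<lambda>x. \<Sum>f\<in>F. (cmod (cinner f (psi x)))\<^sup>2"] by blast
  then show ?thesis
    using order_trans[OF le expected_overlap_le[OF assms]] by blast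
qed

lemma extend_orthonormal:
  assumes on: "orthonormal F" and c: "c \<ge> 0" and small: "top_weight c + c * card F < 1"
  shows "\<exists>w x. x \<in> X \<and> w \<notin> F \<and> orthonormal (insert w F) \<and>
    1 - top_weight c - c * card F \<le> (cmod (cinner w (psi x)))\<^sup>2"
proof -
  obtain x where x: "x \<in> X"
    and overlap: "(\<Sum>g\<in>F. (cmod (cinner g (psi x)))\<^sup>2) \<le> top_weight c + c * card F"
    using exists_small_overlap[OF on c] by blast
  have "(norm (orth_residual F (psi x)))\<^sup>2 = 1 - (\<Sum>g\<in>F. (cmod (cinner g (psi x)))\<^sup>2)"
    using pythagoras_orthonormal[OF on, of "psi x"] norm_psi[OF x] by simp
  then have "0 < (norm (orth_residual F (psi x)))\<^sup>2"
    using overlap small by linarith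
  then have "orth_residual F (psi x) \<noteq> 0"
    by auto
  from orthonormal_insert_normalized_residual[OF on this]
  show ?thesis
    using x overlap norm_psi[OF x] by (intro exI conjI) auto
qed

lemma greedy_orthonormal_family:
  assumes c: "c > 0" and k: "top_weight c + (real k - 1) * c < 1"
  shows "\<exists>f y. inj_on f {..<k} \<and> orthonormal (f ` {..<k}) \<and>
    (\<forall>j<k. y j \<in> X \<and> 1 - top_weight c - real j * c \<le> (cmod (cinner (f j) (psi (y j))))\<^sup>2)"
  using k
proof (induction k)
  case 0
  show ?case
    by (auto simp: orthonormal_def)
next
  case (Suc k)
  have "top_weight c + (real k - 1) * c < 1"
    using Suc.prems c by (simp add: left_diff_distrib)
  then obtain f y where inj: "inj_on f {..<k}" and on: "orthonormal (f ` {..<k})"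
    and good: "\<forall>j<k. y j \<in> X \<and> 1 - top_weight c - real j * c \<le> (cmod (cinner (f j) (psi (y j))))\<^sup>2"
    using Suc.IH by blast
  have "card (f ` {..<k}) = k"
    using inj by (simp add: card_image)
  then obtain w x where x: "x \<in> X" and w: "w \<notin> f ` {..<k}" "orthonormal (insert w (f ` {..<k}))"
    and w_good: "1 - top_weight c - real k * c \<le> (cmod (cinner w (psi x)))\<^sup>2"
    using extend_orthonormal[OF on, of c] c Suc.prems by (auto simp: mult.commute)
  have "f(k := w) ` {..<k} = f ` {..<k}"
    by (intro image_cong) auto
  then have "f(k := w) ` {..<Suc k} = insert w (f ` {..<k})"
    by (simp only: lessThan_Suc image_insert fun_upd_same)
  then have on': "orthonormal (f(k := w) ` {..<Suc k})"
    using w(2) by simp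
  have "inj_on (f(k := w)) {..<k}"
    using inj w(1) by (rule inj_on_fun_updI)
  then have inj': "inj_on (f(k := w)) {..<Suc k}"
    using w(1) by (simp add: lessThan_Suc)
  have good': "\<forall>j<Suc k. (y(k := x)) j \<in> X \<and>
      1 - top_weight c - real j * c \<le> (cmod (cinner ((f(k := w)) j) (psi ((y(k := x)) j))))\<^sup>2"
    using good x w_good by (simp add: less_Suc_eq)
  show ?case
    by (intro exI[of _ "f(k := w)"] exI[of _ "y(k := x)"] conjI inj' on' good')
qed

end

section \<open>Achievability\<close>

lemma sum_lessThan_mult_div:
  fixes g :: "nat \<Rightarrow> 'a::real_vector"
  shows "(\<Sum>i<K * m. g (i div m)) = (\<Sum>j<K. real m *\<^sub>R g j)"
proof -
  have "(\<Sum>i\<in>{j * m..<j * m + m}. g (i div m)) = real m *\<^sub>R g j" for j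
  proof -
    have "i div m = j" if "i \<in> {j * m..<j * m + m}" for i
      using that by (intro div_nat_eqI) (auto simp: mult.commute)
    then have "(\<Sum>i\<in>{j * m..<j * m + m}. g (i div m)) = (\<Sum>i\<in>{j * m..<j * m + m}. g j)"
      by (intro sum.cong) auto
    then show ?thesis
      by (simp add: sum_constant_scaleR)
  qed
  then show ?thesis
    by (simp flip: sum.nat_group)
qed

lemma cinner_outer_plus_complement:
  "cinner v ((a *\<^sub>R (outer u u + b *\<^sub>R (mat 1 - proj_onto F))) *v v)
     = complex_of_real (a * ((cmod (cinner u v))\<^sup>2 + b * ((norm v)\<^sup>2 - (\<Sum>g\<in>F. (cmod (cinner g v))\<^sup>2))))"
proof -
  have "cinner v ((a *\<^sub>R (outer u u + b *\<^sub>R (mat 1 - proj_onto F))) *v v) = complex_of_real a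
      * (cinner v (outer u u *v v) + complex_of_real b * (cinner v v - cinner v (proj_onto F *v v)))"
    by (simp add: matrix_vector_mult_scaleR_left matrix_vector_mult_add_rdistrib
        matrix_vector_mult_diff_rdistrib cinner_add_right cinner_diff_right cinner_scale_right
        distrib_left right_diff_distrib mult.assoc)
  then show ?thesis
    by (simp only: cinner_outer_self cinner_proj_onto cinner_self of_real_mult of_real_add
        of_real_diff)
qed

lemma sum_outer_plus_complement:
  assumes inj: "inj_on f {..<K}" and "K > 0" "m > 0"
  shows "(\<Sum>i<K * m. (1 / real m) *\<^sub>R (outer (f (i div m)) (f (i div m))
      + (1 / real K) *\<^sub>R (mat 1 - proj_onto (f ` {..<K})))) = mat 1"
proof -
  let ?R = "mat 1 - proj_onto (f ` {..<K})"
  have "(\<Sum>j<K. (1 / real K) *\<^sub>R ?R) = ?R"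
    using \<open>K > 0\<close> by (simp only: sum_constant_scaleR card_lessThan scaleR_scaleR) simp
  moreover have "(\<Sum>j<K. outer (f j) (f j)) = proj_onto (f ` {..<K})"
    by (simp add: proj_onto_def sum.reindex[OF inj])
  moreover have "(\<Sum>i<K * m. (1 / real m) *\<^sub>R (outer (f (i div m)) (f (i div m)) + (1 / real K) *\<^sub>R ?R))
      = (\<Sum>j<K. outer (f j) (f j) + (1 / real K) *\<^sub>R ?R)"
    using sum_lessThan_mult_div[of "\<lambda>j. (1 / real m) *\<^sub>R (outer (f j) (f j) + (1 / real K) *\<^sub>R ?R)"]
      \<open>m > 0\<close> by simp
  ultimately show ?thesis
    by (simp add: sum.distrib)
qed

text \<open>Each \<open>f j\<close> is tested \<open>m\<close> times with weight \<open>1 / m\<close>, and the orthogonal complement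
  of the family is shared equally among all outcomes so that the elements sum to the identity.\<close>

lemma povm_from_orthonormal_family:
  fixes f :: "nat \<Rightarrow> complex^'n"
  assumes inj: "inj_on f {..<K}" and on: "orthonormal (f ` {..<K})" and "K > 0" "m > 0"
  shows "\<exists>Q. povm (K * m) Q \<and> (\<forall>i v. (cmod (cinner (f (i div m)) v))\<^sup>2 / m \<le> qform (Q i) v)"
proof -
  define Q where "Q i = (1 / real m) *\<^sub>R (outer (f (i div m)) (f (i div m))
      + (1 / real K) *\<^sub>R (mat 1 - proj_onto (f ` {..<K})))" for i
  define q where "q i v = (1 / real m) * ((cmod (cinner (f (i div m)) v))\<^sup>2
      + (1 / real K) * ((norm v)\<^sup>2 - (\<Sum>g\<in>f ` {..<K}. (cmod (cinner g v))\<^sup>2)))" for i v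
  have cinner_Q: "cinner v (Q i *v v) = complex_of_real (q i v)" for i v
    unfolding Q_def q_def by (rule cinner_outer_plus_complement)
  have Q_ge: "(cmod (cinner (f (i div m)) v))\<^sup>2 / m \<le> q i v" for i v
  proof -
    have "(1 / real m) * (cmod (cinner (f (i div m)) v))\<^sup>2 \<le> q i v"
      unfolding q_def using bessel_inequality[OF on, of v] by (intro mult_left_mono) auto
    then show ?thesis
      by simp
  qed
  have "0 \<le> q i v" for i v
    by (rule order_trans[OF _ Q_ge]) simp
  then have "psd (Q i)" for i
    unfolding psd_def cinner_Q by blast
  then have "povm (K * m) Q"
    using sum_outer_plus_complement[OF assms(1,3,4)] by (simp add: povm_def Q_def)
  moreover have "\<forall>i v. (cmod (cinner (f (i div m)) v))\<^sup>2 / m \<le> qform (Q i) v"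
    using Q_ge by (simp add: qform_def cinner_Q)
  ultimately show ?thesis
    by blast
qed

context pure_family
begin

lemma distinguishable_from_orthonormal_family:
  assumes "inj_on f {..<K}" "orthonormal (f ` {..<K})" "K > 0" "m > 0"
    and y: "\<And>j. j < K \<Longrightarrow> y j \<in> X"
    and good: "\<And>j. j < K \<Longrightarrow> s \<le> (cmod (cinner (f j) (psi (y j))))\<^sup>2"
    and s: "(1 - eps) * real m \<le> s"
  shows "distinguishable W X eps (K * m)"
proof -
  obtain Q where povm: "povm (K * m) Q"
    and Q: "\<And>i v. (cmod (cinner (f (i div m)) v))\<^sup>2 / m \<le> qform (Q i) v"
    using povm_from_orthonormal_family[OF assms(1-4)] by blast
  have j: "i div m < K" if "i < K * m" for i
    using that \<open>m > 0\<close> by (simp add: div_less_iff_less_mult)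
  have "1 - eps \<le> qform (Q i) (psi (y (i div m)))" if "i < K * m" for i
  proof -
    have "1 - eps \<le> s / m"
      using s \<open>m > 0\<close> by (simp add: field_simps)
    also have "\<dots> \<le> (cmod (cinner (f (i div m)) (psi (y (i div m)))))\<^sup>2 / m"
      using good[OF j[OF that]] by (simp add: divide_right_mono)
    finally show ?thesis
      using Q order_trans by blast
  qed
  then have "real (K * m) * (1 - eps) \<le> (\<Sum>i<K * m. qform (Q i) (psi (y (i div m))))"
    using sum_mono[of "{..<K * m}" "\<lambda>_. 1 - eps"] by simp
  moreover have "0 < K * m"
    using assms(3,4) by simp
  ultimately show ?thesis
    unfolding distinguishable_iff_success[OF \<open>0 < K * m\<close>]
    using povm y j by (intro exI[of _ "\<lambda>i. y (i div m)"] exI[of _ Q]) auto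
qed

end

lemma real_nat_floor_bounds:
  fixes x :: real
  assumes "0 \<le> x"
  shows "real (nat \<lfloor>x\<rfloor>) \<le> x" "x < real (nat \<lfloor>x\<rfloor>) + 1"
proof -
  have "real (nat \<lfloor>x\<rfloor>) = of_int \<lfloor>x\<rfloor>"
    using assms by simp
  then show "real (nat \<lfloor>x\<rfloor>) \<le> x" "x < real (nat \<lfloor>x\<rfloor>) + 1"
    by simp_all
qed

context ensemble_eigenbasis
begin

lemma exists_large_code:
  assumes eps: "0 < eps" "eps < 1" and d: "0 < d1" "0 < d2" and c: "0 < c"
    and weight: "top_weight c \<le> eps - d1 - d2"
  shows "\<exists>N. distinguishable W X eps N \<and> d1 / c * (d2 / (1 - eps)) \<le> real N"
proof -
  define K where "K = nat \<lfloor>d1 / c\<rfloor> + 1"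
  define m where "m = nat \<lfloor>1 + d2 / (1 - eps)\<rfloor>"
  have "0 \<le> d1 / c" "0 < d2 / (1 - eps)"
    using d c eps by simp_all
  note K_floor = real_nat_floor_bounds[OF \<open>0 \<le> d1 / c\<close>]
  note m_floor = real_nat_floor_bounds[of "1 + d2 / (1 - eps)", folded m_def]
  have K: "(real K - 1) * c \<le> d1" "d1 / c \<le> real K"
    using K_floor c by (simp_all add: K_def pos_le_divide_eq)
  have m: "d2 / (1 - eps) \<le> real m" "real m \<le> 1 + d2 / (1 - eps)"
    using m_floor \<open>0 < d2 / (1 - eps)\<close> by linarith+
  then have "0 < m"
    using \<open>0 < d2 / (1 - eps)\<close> by simp
  have "(1 - eps) * real m \<le> 1 - eps + d2"
    using m(2) eps by (simp add: field_simps)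
  obtain f y where "inj_on f {..<K}" "orthonormal (f ` {..<K})"
    and fy: "\<forall>j<K. y j \<in> X \<and> 1 - top_weight c - real j * c \<le> (cmod (cinner (f j) (psi (y j))))\<^sup>2"
    using greedy_orthonormal_family[OF c, of K] K weight eps d by fastforce
  moreover have "1 - eps + d2 \<le> (cmod (cinner (f j) (psi (y j))))\<^sup>2" if "j < K" for j
  proof -
    have "real j * c \<le> (real K - 1) * c"
      using that c by (intro mult_right_mono) auto
    then show ?thesis
      using fy that K weight by fastforce
  qed
  ultimately have "distinguishable W X eps (K * m)"
    using fy \<open>0 < m\<close> \<open>(1 - eps) * real m \<le> 1 - eps + d2\<close>
    by (intro distinguishable_from_orthonormal_family) (auto simp: K_def)
  moreover have "d1 / c * (d2 / (1 - eps)) \<le> real K * real m"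
    using K(2) m(1) d c eps by (intro mult_mono) auto
  ultimately show ?thesis
    by (intro exI[of _ "K * m"]) simp
qed

end

context pure_family
begin

lemma Hs_mixture_le:
  assumes eps: "0 < eps" "eps < 1" and d: "0 < d1" "0 < d2" and P: "P \<in> distributions X"
  shows "Hs (eps - d1 - d2) (mixture W X P)
    \<le> ereal (ln (real (Mdist W X eps)) + ln ((1 - eps) / (d1 * d2)))"
proof -
  interpret pure_ensemble W X psi P
    by unfold_locales (rule P)
  obtain B lam where "eigenbasis (mixture W X P) B lam"
    using exists_eigenbasis by blast
  then interpret ensemble_eigenbasis W X psi P B lam
    by unfold_locales
  let ?M = "real (Mdist W X eps)"
  show ?thesis
  proof (rule Hs_le_ereal)
    fix l
    assume "Re (trace (mixture W X P ** proj_ge (mixture W X P) (exp (- l)))) \<le> eps - d1 - d2"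
    then obtain N where "distinguishable W X eps N" and N: "d1 / exp (- l) * (d2 / (1 - eps)) \<le> N"
      using exists_large_code[OF eps d exp_gt_zero] by (auto simp: trace_proj_ge_mixture)
    moreover have "d1 / exp (- l) * (d2 / (1 - eps)) = exp l * (d1 * d2 / (1 - eps))"
      by (simp add: exp_minus field_simps)
    ultimately have "exp l * (d1 * d2 / (1 - eps)) \<le> ?M"
      using le_Mdist[of eps N] eps by (smt (verit) of_nat_le_iff)
    then have "exp l \<le> ?M * ((1 - eps) / (d1 * d2))"
      using eps d by (simp add: field_simps)
    moreover have pos: "0 < ?M" "0 < (1 - eps) / (d1 * d2)"
      using eps d Mdist_ge_1[of eps] by auto
    ultimately have "l \<le> ln (?M * ((1 - eps) / (d1 * d2)))"
      using ln_ge_iff[OF mult_pos_pos[OF pos]] by blast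
    then show "l \<le> ln ?M + ln ((1 - eps) / (d1 * d2))"
      by (simp only: ln_mult_pos[OF pos])
  qed
qed

end

section \<open>Converse\<close>

text \<open>Split \<open>v\<close> into its components inside and outside the span of \<open>S\<close>; the former is
  handled by Cauchy--Schwarz, the latter by \<open>Q \<le> 1\<close>.\<close>

lemma qform_le_split_basis:
  assumes B: "orthonormal_basis B" and S: "S \<subseteq> B" and Q: "psd Q"
    and Q_le: "\<And>v. qform Q v \<le> (norm v)\<^sup>2" and v: "norm v = 1" and t: "t > 0"
  shows "qform Q v \<le> (1 + t) * (\<Sum>u\<in>S. qform Q u) + (1 + 1 / t) * (1 - (\<Sum>u\<in>S. (cmod (cinner u v))\<^sup>2))"
proof -
  have on: "orthonormal B" and fin: "finite B"
    using B orthonormal_finite by (auto simp: orthonormal_basis_def)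
  define a where "a = (\<Sum>u\<in>S. cinner u v *s u)"
  define b where "b = (\<Sum>u\<in>B - S. cinner u v *s u)"
  have "v = (\<Sum>u\<in>B. cinner u v *s u)"
    by (rule orthonormal_basis_expansion[OF B, symmetric])
  also have "\<dots> = a + b"
    unfolding a_def b_def by (rule sum.subset_diff[OF S fin, THEN trans, OF add.commute])
  finally have "v = a + b" .
  moreover have "qform Q a \<le> (\<Sum>u\<in>S. qform Q u)"
  proof -
    have "qform Q a \<le> (\<Sum>u\<in>S. (cmod (cinner u v))\<^sup>2) * (\<Sum>u\<in>S. qform Q u)"
      unfolding a_def by (rule qform_lincomb_le[OF Q])
    also have "\<dots> \<le> 1 * (\<Sum>u\<in>S. qform Q u)"
      using bessel_inequality[OF orthonormal_subset[OF on S], of v] v qform_nonneg[OF Q]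
      by (intro mult_right_mono sum_nonneg) auto
    finally show ?thesis
      by simp
  qed
  moreover have "qform Q b \<le> 1 - (\<Sum>u\<in>S. (cmod (cinner u v))\<^sup>2)"
  proof -
    have "qform Q b \<le> (\<Sum>u\<in>B - S. (cmod (cinner u v))\<^sup>2)"
      using Q_le[of b] norm_orthonormal_sum[OF on, of "B - S"] by (simp add: b_def)
    also have "\<dots> = 1 - (\<Sum>u\<in>S. (cmod (cinner u v))\<^sup>2)"
      unfolding sum_diff[OF fin S] using parseval[OF B, of v] v by simp
    finally show ?thesis .
  qed
  ultimately show ?thesis
    using qform_add_le[OF Q t, of a b] t by (smt (verit) mult_left_mono divide_pos_pos)
qed

context ensemble_eigenbasis
begin

lemma success_le_top_eigvecs:
  fixes t :: real
  assumes povm: "povm N Q" and xs: "\<forall>i<N. xs i \<in> X" and N: "N > 0" and t: "t > 0"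
    and P_emp: "\<And>x. x \<in> X \<Longrightarrow> P x = empirical N xs x"
  shows "(\<Sum>i<N. qform (Q i) (psi (xs i)))
    \<le> (1 + t) * card (top_eigvecs c) + (1 + 1 / t) * (real N - real N * top_weight c)"
proof -
  let ?S = "top_eigvecs c"
  let ?s = "\<lambda>x. \<Sum>u\<in>?S. (cmod (cinner u (psi x)))\<^sup>2"
  have "qform (Q i) (psi (xs i)) \<le> (1 + t) * (\<Sum>u\<in>?S. qform (Q i) u) + (1 + 1 / t) * (1 - ?s (xs i))"
    if "i < N" for i
    using qform_le_split_basis[OF onb top_eigvecs_subset _ qform_le_norm_povm[OF povm that]
        norm_psi t] povm that xs by (simp add: povm_def)
  then have "(\<Sum>i<N. qform (Q i) (psi (xs i)))
      \<le> (\<Sum>i<N. (1 + t) * (\<Sum>u\<in>?S. qform (Q i) u) + (1 + 1 / t) * (1 - ?s (xs i)))"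
    by (intro sum_mono) simp
  also have "\<dots> = (1 + t) * (\<Sum>u\<in>?S. \<Sum>i<N. qform (Q i) u)
      + (1 + 1 / t) * (real N - (\<Sum>i<N. ?s (xs i)))"
    by (simp add: sum.distrib sum_subtractf sum.swap[of _ "{..<N}"] flip: sum_distrib_left)
  also have "(\<Sum>u\<in>?S. \<Sum>i<N. qform (Q i) u) = card ?S"
    by (rule qform_povm_sum_basis[OF povm orthonormal_subset[OF on top_eigvecs_subset]])
  also have "(\<Sum>i<N. ?s (xs i)) = real N * top_weight c"
    using sum_empirical_mult[OF finite_X xs, of ?s] N P_emp
    by (simp add: top_weight_eq_expectation)
  finally show ?thesis .
qed

end

lemma converse_arith:
  fixes N S T eps d1 d2 :: real
  assumes N: "N > 0" and d: "d1 > 0" "d2 > 0" and eps: "eps \<ge> 0" and T: "T \<le> 1"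
    and success: "N * (1 - eps) \<le> (1 + 1 / d2) * S + (1 + d2) * (N - N * T)"
    and S: "S \<le> N * d1 * d2\<^sup>2"
  shows "T \<le> eps + d1 + 2 * d2"
proof (cases "d2 < 1")
  case True
  have "(1 + 1 / d2) * S \<le> (1 + 1 / d2) * (N * d1 * d2\<^sup>2)"
    using S d by (intro mult_left_mono) auto
  also have "\<dots> = N * (d1 * d2 * (1 + d2))"
    using d by (simp add: field_simps power2_eq_square)
  finally have "N * (1 - eps) \<le> N * (d1 * d2 * (1 + d2) + (1 + d2) * (1 - T))"
    using success by (simp add: algebra_simps)
  then have "1 - eps \<le> d1 * d2 * (1 + d2) + (1 + d2) * (1 - T)"
    using N by simp
  moreover have "d1 * d2 * (1 + d2) \<le> d1 * (1 + d2)"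
    using d True by (intro mult_right_mono) auto
  moreover have "d2 + eps \<le> (d2 + eps) * (1 + d2)"
    using d eps by (simp add: algebra_simps)
  ultimately have "(1 + d2) * T \<le> (1 + d2) * (d1 + d2 + eps)"
    by (simp add: algebra_simps)
  then show ?thesis
    using d by simp
next
  case False
  then show ?thesis
    using T d eps by simp
qed

context ensemble_eigenbasis
begin

lemma top_weight_le_of_code:
  assumes povm: "povm N Q" and xs: "\<forall>i<N. xs i \<in> X" and N: "N > 0"
    and P_emp: "\<And>x. x \<in> X \<Longrightarrow> P x = empirical N xs x"
    and success: "real N * (1 - eps) \<le> (\<Sum>i<N. qform (Q i) (psi (xs i)))"
    and eps: "0 \<le> eps" and d: "0 < d1" "0 < d2"
  shows "top_weight (1 / (real N * (d1 * d2\<^sup>2))) \<le> eps + d1 + 2 * d2"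
proof -
  define c where "c = 1 / (real N * (d1 * d2\<^sup>2))"
  have "c * card (top_eigvecs c) \<le> 1"
    using card_top_eigvecs_le[of c] top_weight_le_1[of c] by linarith
  then have card: "card (top_eigvecs c) \<le> real N * d1 * d2\<^sup>2"
    using N d by (simp add: c_def field_simps)
  have "(\<Sum>i<N. qform (Q i) (psi (xs i)))
      \<le> (1 + 1 / d2) * card (top_eigvecs c) + (1 + d2) * (real N - real N * top_weight c)"
    using success_le_top_eigvecs[OF povm xs N, of "1 / d2" c] d P_emp by simp
  then show ?thesis
    unfolding c_def[symmetric] using N d eps success top_weight_le_1[of c] card
    by (intro converse_arith[of "real N" d1 d2 eps "top_weight c" "card (top_eigvecs c)"]) auto
qed

end

context pure_family
begin

lemma Hs_mixture_ge:
  assumes eps: "0 < eps" "eps < 1" and d: "0 < d1" "0 < d2"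
  shows "\<exists>P\<in>distributions X. ereal (ln (real (Mdist W X eps)) + ln (d1 * d2\<^sup>2))
    \<le> Hs (eps + d1 + 2 * d2) (mixture W X P)"
proof -
  let ?M = "Mdist W X eps"
  have "0 < ?M"
    using Mdist_ge_1[of eps] eps by simp
  then obtain xs Q where xs: "\<forall>i<?M. xs i \<in> X" and povm: "povm ?M Q"
    and success: "real ?M * (1 - eps) \<le> (\<Sum>i<?M. qform (Q i) (psi (xs i)))"
    using distinguishable_Mdist[of eps] distinguishable_iff_success eps by auto
  define P where "P = empirical ?M xs"
  have P: "P \<in> distributions X"
    unfolding P_def using empirical_distribution[OF finite_X xs \<open>0 < ?M\<close>] .
  interpret pure_ensemble W X psi P
    by unfold_locales (rule P)
  obtain B lam where "eigenbasis (mixture W X P) B lam"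
    using exists_eigenbasis by blast
  then interpret ensemble_eigenbasis W X psi P B lam
    by unfold_locales
  have "exp (ln (real ?M) + ln (d1 * d2\<^sup>2)) = real ?M * (d1 * d2\<^sup>2)"
    using \<open>0 < ?M\<close> d by (simp add: exp_add)
  then have exp_eq: "exp (- (ln (real ?M) + ln (d1 * d2\<^sup>2))) = 1 / (real ?M * (d1 * d2\<^sup>2))"
    unfolding exp_minus by (simp add: inverse_eq_divide)
  have "top_weight (1 / (real ?M * (d1 * d2\<^sup>2))) \<le> eps + d1 + 2 * d2"
    using top_weight_le_of_code[OF povm xs \<open>0 < ?M\<close> _ success] eps d by (simp add: P_def)
  then have "ereal (ln (real ?M) + ln (d1 * d2\<^sup>2)) \<le> Hs (eps + d1 + 2 * d2) (mixture W X P)"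
    by (intro ereal_le_Hs) (unfold exp_eq trace_proj_ge_mixture)
  then show ?thesis
    using P by blast
qed

end

theorem mainTheorem5:
  fixes X :: "'x set" and W :: "'x \<Rightarrow> complex^'n^'n"
    and eps d1 d2 :: real
  assumes "finite X" and "X \<noteq> {}"
    and "\<forall>x\<in>X. pure_state (W x)"
    and "0 < eps" and "eps < 1" and "0 < d1" and "0 < d2"
  shows "(ereal (ln (real (Mdist W X eps))) \<ge>
           (SUP P\<in>distributions X. Hs (eps - d1 - d2) (mixture W X P))
             - ereal (ln ((1 - eps) / (d1 * d2)))) \<and>
         (ereal (ln (real (Mdist W X eps))) \<le>
           (SUP P\<in>distributions X. Hs (eps + d1 + 2 * d2) (mixture W X P))
             + ereal (ln (1 / (d1 * d2^2))))"
proof -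
  obtain psi where "\<And>x. x \<in> X \<Longrightarrow> norm (psi x) = 1 \<and> W x = outer (psi x) (psi x)"
    using assms(3) unfolding pure_state_def by metis
  then interpret pure_family W X psi
    using assms(1,2) by unfold_locales auto
  let ?lnM = "ln (real (Mdist W X eps))"
  have lower: "(SUP P\<in>distributions X. Hs (eps - d1 - d2) (mixture W X P))
      \<le> ereal (?lnM + ln ((1 - eps) / (d1 * d2)))"
    using Hs_mixture_le assms(4-7) by (intro SUP_least) auto
  obtain P where P: "P \<in> distributions X"
    and le: "ereal (?lnM + ln (d1 * d2^2)) \<le> Hs (eps + d1 + 2 * d2) (mixture W X P)"
    using Hs_mixture_ge[OF assms(4-7)] by blast
  have upper: "ereal (?lnM + ln (d1 * d2^2))
      \<le> (SUP P\<in>distributions X. Hs (eps + d1 + 2 * d2) (mixture W X P))"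
    using le by (rule order_trans[OF _ SUP_upper[OF P]])
  have "ln (1 / (d1 * d2^2)) = - ln (d1 * d2^2)"
    using assms(6,7) by (simp add: ln_div)
  with lower upper show ?thesis
    by (cases "SUP P\<in>distributions X. Hs (eps - d1 - d2) (mixture W X P)";
        cases "SUP P\<in>distributions X. Hs (eps + d1 + 2 * d2) (mixture W X P)") auto
qed

end
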